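(* Let $\alpha\ge 0$, and for $t>0$ let $G_t$ be the event that zero or finitely many branches of the $\alpha$-Riccati cascade crossed $t$, i.e. $G_t=[\,|V(t)|<\infty\,]$, where $V(t)$ is the set of $t$-leaves of the cascade. Then, for every $t>0$, $$\mathbb{P}(G_t)=1 \quad\text{if } \alpha\in[0,1]\cup[2,\infty),\qquad\text{and}\qquad \mathbb{P}(G_t)<1\quad\text{if } \alpha\in(1,2).$$
   Context: Let $\mathcal{I}=\{\emptyset\}\cup\bigcup_{n\in\mathbb{N}}\{1,2\}^n$ (with $\mathbb{N}=\{1,2,\dots\}$) be the vertex set of the infinite rooted binary tree with root $\emptyset$. For $v\in\{1,2\}^n$ write $|v|=n$ (and $|\emptyset|=0$), and for $0\le j\le |v|$ let $v|j$ denote the truncation of $v$ to its first $j$ coordinates, with $v|0=\emptyset$. Let $\{T_v\}_{v\in\mathcal{I}}$ be i.i.d. exponential random variables with mean one. The family $\{\alpha^{-|v|}T_v\}_{v\in\mathcal{I}}$ is called the $\alpha$-Riccati cascade. For $t>0$ the set of $t$-leaves is $$V(t)=\Big\{v\in\mathcal{I}:\ \sum_{j=0}^{|v|-1}\alpha^{-j}T_{v|j}\le t<\sum_{j=0}^{|v|}\alpha^{-j}T_{v|j}\Big\},$$ where an empty sum equals $0$. When $\alpha=0$, the convention is $\alpha^{0}=1$ and $\alpha^{-j}T_{v|j}=+\infty$ for $j\ge1$. A branch crossing $t$ corresponds to an element of $V(t)$. *)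

theory Defs
  imports "HOL-Probability.Probability"
begin

definition tree_vertices :: "nat list set" where
  "tree_vertices = lists {1, 2}"

text \<open>
  The values are extended reals because of the convention
  \<open>\<alpha>\<^sup>-\<^sup>j T\<^sub>v = \<infinity>\<close> for \<open>\<alpha> = 0\<close> and \<open>j \<ge> 1\<close>.
\<close>

definition riccati_cascade ::
    "real \<Rightarrow> (nat list \<Rightarrow> 'a \<Rightarrow> real) \<Rightarrow> nat list \<Rightarrow> 'a \<Rightarrow> ereal" where
  "riccati_cascade \<alpha> T v \<omega> =
     (if \<alpha> = 0 \<and> length v \<ge> 1 then \<infinity>
      else ereal (\<alpha> powi (- int (length v)) * T v \<omega>))"

definition t_leaves ::
    "real \<Rightarrow> (nat list \<Rightarrow> 'a \<Rightarrow> real) \<Rightarrow> real \<Rightarrow> 'a \<Rightarrow> nat list set" where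
  "t_leaves \<alpha> T t \<omega> =
     {v \<in> tree_vertices.
        (\<Sum>j<length v. riccati_cascade \<alpha> T (take j v) \<omega>) \<le> ereal t \<and>
        ereal t < (\<Sum>j\<le>length v. riccati_cascade \<alpha> T (take j v) \<omega>)}"

definition finite_crossing_event ::
    "'a measure \<Rightarrow> real \<Rightarrow> (nat list \<Rightarrow> 'a \<Rightarrow> real) \<Rightarrow> real \<Rightarrow> 'a set" where
  "finite_crossing_event M \<alpha> T t = {\<omega> \<in> space M. finite (t_leaves \<alpha> T t \<omega>)}"

text \<open>
  The set above is an event.  Without this, a bound \<open>measure M A < 1\<close> would carry no
  information, since \<open>measure M A = 0\<close> for non-measurable \<open>A\<close>.
\<close>

lemma finite_crossing_event_sets:
  assumes T: "\<And>v. v \<in> tree_vertices \<Longrightarrow> T v \<in> borel_measurable M"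
  shows "finite_crossing_event M \<alpha> T t \<in> sets M"
proof -
  have take: "take j v \<in> tree_vertices" if "v \<in> tree_vertices" for j v
    using that set_take_subset[of j v] by (auto simp: tree_vertices_def in_lists_conv_set)
  have casc: "(\<lambda>\<omega>. riccati_cascade \<alpha> T v \<omega>) \<in> borel_measurable M" if "v \<in> tree_vertices" for v
    using T[OF that] unfolding riccati_cascade_def by (cases "\<alpha> = 0 \<and> length v \<ge> 1") auto
  have leaf: "{\<omega> \<in> space M. v \<notin> t_leaves \<alpha> T t \<omega>} \<in> sets M" if v: "v \<in> tree_vertices" for v
  proof -
    have "(\<lambda>\<omega>. \<Sum>j\<in>J. riccati_cascade \<alpha> T (take j v) \<omega>) \<in> borel_measurable M" for J
      by (intro borel_measurable_ereal_sum casc take v)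
    note [measurable] = this
    have "Measurable.pred M (\<lambda>\<omega>. \<not> ((\<Sum>j<length v. riccati_cascade \<alpha> T (take j v) \<omega>) \<le> ereal t \<and>
        ereal t < (\<Sum>j\<le>length v. riccati_cascade \<alpha> T (take j v) \<omega>)))"
      by measurable
    then show ?thesis using v by (simp add: t_leaves_def pred_def)
  qed
  have leaf': "{\<omega> \<in> space M. v \<notin> t_leaves \<alpha> T t \<omega>} \<in> sets M" for v
    by (cases "v \<in> tree_vertices") (simp_all add: leaf, simp add: t_leaves_def)
  let ?F = "{F. finite F \<and> F \<subseteq> tree_vertices}"
  have cF: "countable ?F"
    by (rule countable_Collect_finite_subset) simp
  have "finite_crossing_event M \<alpha> T t =
      {\<omega> \<in> space M. \<exists>F\<in>?F. \<forall>v\<in>tree_vertices - F. v \<notin> t_leaves \<alpha> T t \<omega>}" (is "_ = ?R")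
  proof
    show "finite_crossing_event M \<alpha> T t \<subseteq> ?R"
      unfolding finite_crossing_event_def
      by (auto intro!: exI[of _ "t_leaves \<alpha> T t _"] simp: t_leaves_def)
    have "finite (t_leaves \<alpha> T t \<omega>)"
      if "finite F" "\<forall>v\<in>tree_vertices - F. v \<notin> t_leaves \<alpha> T t \<omega>" for F \<omega>
      using that by (intro finite_subset[OF _ that(1)]) (auto simp: t_leaves_def)
    then show "?R \<subseteq> finite_crossing_event M \<alpha> T t"
      unfolding finite_crossing_event_def by blast
  qed
  also have "?R =
      (\<Union>F\<in>?F. {\<omega> \<in> space M. \<forall>v\<in>tree_vertices - F. v \<notin> t_leaves \<alpha> T t \<omega>})"
    by auto
  also have "\<dots> \<in> sets M"
  proof (intro sets.countable_UN'' cF)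
    fix F
    show "{\<omega> \<in> space M. \<forall>v\<in>tree_vertices - F. v \<notin> t_leaves \<alpha> T t \<omega>} \<in> sets M"
      by (rule sets.sets_Collect_countable_Ball) (rule leaf')
  qed
  finally show ?thesis .
qed

end

theory Submission
  imports Defs
begin

text \<open>
  Write \<open>q n t\<close> for the probability that the cascade has a \<open>t\<close>-leaf of depth at least \<open>n\<close>.  Each
  level of the tree is finite, so \<open>V t\<close> is infinite exactly when it has leaves of every depth, and
  the probability of that is \<open>w t = lim q n t\<close>.  The theorem is about whether \<open>w\<close> vanishes.

  The law of the clocks is an infinite product, and a tree of clocks is a root clock with two
  independent copies of itself grafted on top.  Seen from a child, the remaining time
  \<open>t - x\<close> is multiplied by \<open>\<alpha>\<close>.  With \<open>either p = 2 p - p\<^sup>2\<close>, the probability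
  that at least one of two independent events of probability \<open>p\<close> occurs, conditioning on the root
  clock gives (lemma \<open>leaf_prob_recursion\<close>)
  \<open>q (n + 1) t = \<integral> exp (- (t - s)) * either (q n (\<alpha> * s)) ds\<close> over \<open>0 \<le> s \<le> t\<close>.
  Everything else is analysis of this equation.

  For \<open>0 < \<alpha> \<le> 1\<close> the crude bound \<open>either p \<le> 2 p\<close> already iterates to
  \<open>q n t \<le> (2 t) ^ n / n!\<close>, because \<open>\<alpha> * s \<le> s\<close>.  For \<open>\<alpha> = 0\<close> no leaf is deeper than a child of
  the root.

  For \<open>\<alpha> > 1\<close> the key quantity is the mass \<open>I n = \<integral> q n t dt\<close> over all times.  It is finite: once
  \<open>t\<close> is large, all paths of the tree explode before \<open>t\<close> and there is no leaf at all, except with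
  exponentially small probability (lemma \<open>finite_total_mass\<close>).  Integrating the recursion,
  by Tonelli, gives the exact balance
  \<open>\<alpha> * I (n + 1) = \<integral> either (q n) = 2 * I n - \<integral> (q n)\<^sup>2\<close>,
  and dominated convergence gives the same for \<open>w\<close>: \<open>\<alpha> * \<integral> w = 2 * \<integral> w - \<integral> w\<^sup>2\<close>.

  If \<open>\<alpha> \<ge> 2\<close>, this forces \<open>\<integral> w\<^sup>2 = 0\<close>, including in the critical case \<open>\<alpha> = 2\<close> where the expected
  number of leaves is infinite; hence \<open>I n \<rightarrow> 0\<close>, and \<open>q (n + 1) t \<le> (2 / \<alpha>) * I n\<close> yields \<open>w = 0\<close>
  at every single time.

  If \<open>1 < \<alpha> < 2\<close> and \<open>w\<close> vanished identically, then \<open>I n \<rightarrow> 0\<close>, so by the same bound \<open>q n\<close> would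
  become uniformly smaller than \<open>2 - \<alpha>\<close>.  From then on \<open>either (q n) = q n * (2 - q n) \<ge> \<alpha> * q n\<close>,
  and the balance makes the positive numbers \<open>I n\<close> nondecreasing, a contradiction.  So \<open>w\<close> is positive
  somewhere, and the fixed point equation carries positivity to every \<open>t > 0\<close>: upwards because
  \<open>exp t * w t\<close> is nondecreasing, downwards because \<open>w r > 0\<close> implies \<open>w t > 0\<close> whenever
  \<open>r < \<alpha> * t\<close>.
\<close>

section \<open>The law of the clocks and its self-similarity\<close>

lemma Nil_tree [simp]: "[] \<in> tree_vertices"
  by (simp add: tree_vertices_def)

lemma Cons_tree [simp]: "i # u \<in> tree_vertices \<longleftrightarrow> i \<in> {1, 2} \<and> u \<in> tree_vertices"
  by (auto simp: tree_vertices_def)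

definition exp_law :: "real measure" where
  "exp_law = density lborel (exponential_density 1)"

definition clock_law :: "(nat list \<Rightarrow> real) measure" where
  "clock_law = (\<Pi>\<^sub>M v\<in>tree_vertices. exp_law)"

lemma sets_exp_law [simp, measurable_cong]: "sets exp_law = sets borel"
  by (simp add: exp_law_def)

lemma space_exp_law [simp]: "space exp_law = UNIV"
  by (simp add: exp_law_def)

lemma space_clock_law: "space clock_law = extensional tree_vertices"
  by (simp add: clock_law_def space_PiM PiE_def)

interpretation exp_law: prob_space exp_law
  unfolding exp_law_def by (rule prob_space_exponential_density) simp

interpretation clocks: product_prob_space "\<lambda>_. exp_law" tree_vertices
  by unfold_locales

interpretation clock_law: prob_space clock_law
  unfolding clock_law_def by (rule clocks.P.prob_space_axioms)

interpretation clock_pair: pair_prob_space clock_law clock_law ..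

definition graft :: "real \<times> (nat list \<Rightarrow> real) \<times> (nat list \<Rightarrow> real) \<Rightarrow> nat list \<Rightarrow> real" where
  "graft = (\<lambda>(x, f, g). \<lambda>v\<in>tree_vertices.
     case v of [] \<Rightarrow> x | i # u \<Rightarrow> if i = 1 then f u else g u)"

lemma clock_component:
  "v \<in> tree_vertices \<Longrightarrow> (\<lambda>f. f v) \<in> borel_measurable clock_law"
  using measurable_component_singleton[of v tree_vertices "\<lambda>_. exp_law"]
  by (simp add: clock_law_def cong: measurable_cong_sets)

lemma measurable_graft [measurable]:
  "graft \<in> exp_law \<Otimes>\<^sub>M (clock_law \<Otimes>\<^sub>M clock_law) \<rightarrow>\<^sub>M clock_law"
proof -
  have "(\<lambda>p. case v of [] \<Rightarrow> fst p | i # u \<Rightarrow> if i = 1 then fst (snd p) u else snd (snd p) u)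
      \<in> exp_law \<Otimes>\<^sub>M (clock_law \<Otimes>\<^sub>M clock_law) \<rightarrow>\<^sub>M exp_law"
    if v: "v \<in> tree_vertices" for v
    using v by (cases v) (auto intro!: measurable_compose[OF _ clock_component] cong: measurable_cong_sets)
  then show ?thesis
    unfolding graft_def clock_law_def case_prod_beta by (rule measurable_restrict)
qed

text \<open>
  Self-similarity of the cascade.  Two measures on an infinite product agree once they agree on
  finite-dimensional boxes, and a box pulls back under \<open>graft\<close> to a product of three boxes: the
  constraint on the root and those on the two subtrees.
\<close>

lemma distr_graft:
  "distr (exp_law \<Otimes>\<^sub>M (clock_law \<Otimes>\<^sub>M clock_law)) clock_law graft = clock_law"
proof -
  let ?P = "exp_law \<Otimes>\<^sub>M (clock_law \<Otimes>\<^sub>M clock_law)"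
  have "distr ?P clock_law graft = (\<Pi>\<^sub>M v\<in>tree_vertices. exp_law)"
  proof (rule clocks.PiM_eq)
    fix J and F :: "nat list \<Rightarrow> real set"
    assume J: "finite J" "J \<subseteq> tree_vertices" and F: "\<And>j. j \<in> J \<Longrightarrow> F j \<in> sets exp_law"
    define K where "K i = {u. i # u \<in> J}" for i
    define A where "A = (if [] \<in> J then F [] else UNIV)"
    define B where "B i = {f \<in> space clock_law. \<forall>u\<in>K i. f u \<in> F (i # u)}" for i
    have finK: "finite (K i)" for i
    proof -
      have "K i = (#) i -` J" by (auto simp: K_def)
      then show ?thesis using J(1) by (simp add: finite_vimageI)
    qed
    have KV: "K i \<subseteq> tree_vertices" for i using J(2) by (auto simp: K_def)
    have J_eq: "J = (J \<inter> {[]}) \<union> ((#) 1 ` K 1 \<union> (#) 2 ` K 2)"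
    proof (intro set_eqI)
      fix v show "v \<in> J \<longleftrightarrow> v \<in> (J \<inter> {[]}) \<union> ((#) 1 ` K 1 \<union> (#) 2 ` K 2)"
        using J(2) by (cases v) (fastforce simp: K_def image_iff)+
    qed
    have A: "A \<in> sets exp_law" using F by (auto simp: A_def)
    have FK: "F (i # u) \<in> sets exp_law" if "u \<in> K i" for i u
      using F that by (auto simp: K_def)
    have "{f \<in> space clock_law. f u \<in> F (i # u)} \<in> sets clock_law" if "u \<in> K i" for i u
      using measurable_sets[OF clock_component[of u], of "F (i # u)"] FK[OF that] subsetD[OF KV that]
      by (auto simp: vimage_def Int_def conj_commute)
    then have B: "B i \<in> sets clock_law" for i
      unfolding B_def using finK by (intro sets.sets_Collect_finite_All) auto
    have emB: "emeasure clock_law (B i) = (\<Prod>u\<in>K i. emeasure exp_law (F (i # u)))" for i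
      unfolding B_def clock_law_def using finK KV FK by (intro clocks.emeasure_PiM_Collect) auto
    have emA: "emeasure exp_law A = (\<Prod>v\<in>J \<inter> {[]}. emeasure exp_law (F v))"
      using exp_law.emeasure_space_1 by (simp add: A_def)
    have prod_J: "(\<Prod>v\<in>J. e v) = (\<Prod>v\<in>J \<inter> {[]}. e v) *
        ((\<Prod>u\<in>K 1. e (1 # u)) * (\<Prod>u\<in>K 2. e (2 # u)))" for e :: "nat list \<Rightarrow> ennreal"
    proof -
      have "(\<Prod>v\<in>J. e v) = prod e (J \<inter> {[]} \<union> ((#) 1 ` K 1 \<union> (#) 2 ` K 2))"
        using J_eq by simp
      also have "\<dots> = prod e (J \<inter> {[]}) * prod e ((#) 1 ` K 1 \<union> (#) 2 ` K 2)"
        using finK J(1) by (intro prod.union_disjoint) auto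
      also have "prod e ((#) 1 ` K 1 \<union> (#) 2 ` K 2) = prod e ((#) 1 ` K 1) * prod e ((#) 2 ` K 2)"
        using finK by (intro prod.union_disjoint) auto
      finally show ?thesis by (simp add: prod.reindex)
    qed
    let ?E = "prod_emb tree_vertices (\<lambda>_. exp_law) J (\<Pi>\<^sub>E j\<in>J. F j)"
    have E: "?E \<in> sets clock_law"
      unfolding clock_law_def using J F by (intro sets_PiM_I) auto
    have pre: "graft -` ?E \<inter> space ?P = A \<times> (B 1 \<times> B 2)"
    proof (intro set_eqI iffI)
      fix p assume "p \<in> graft -` ?E \<inter> space ?P"
      then obtain x f g where p: "p = (x, f, g)" "f \<in> space clock_law" "g \<in> space clock_law"
        and G: "\<And>v. v \<in> J \<Longrightarrow> graft (x, f, g) v \<in> F v"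
        by (cases p) (auto simp: space_pair_measure prod_emb_def)
      have "x \<in> A" using G[of "[]"] by (auto simp: A_def graft_def)
      moreover have "f \<in> B 1" using G[of "1 # _"] p J(2) by (fastforce simp: B_def K_def graft_def)
      moreover have "g \<in> B 2" using G[of "2 # _"] p J(2) by (fastforce simp: B_def K_def graft_def)
      ultimately show "p \<in> A \<times> (B 1 \<times> B 2)" using p by simp
    next
      fix p assume "p \<in> A \<times> (B 1 \<times> B 2)"
      then obtain x f g where p: "p = (x, f, g)" "x \<in> A" "f \<in> B 1" "g \<in> B 2" by auto
      have "graft (x, f, g) v \<in> F v" if v: "v \<in> J" for v
        using v p J(2) by (cases v) (auto simp: graft_def A_def B_def K_def split: if_splits)
      then show "p \<in> graft -` ?E \<inter> space ?P"
        using p J(2) by (auto simp: space_pair_measure prod_emb_def B_def graft_def PiE_iff extensional_def)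
    qed
    have "emeasure (distr ?P clock_law graft) ?E = emeasure ?P (A \<times> (B 1 \<times> B 2))"
      using E by (simp add: emeasure_distr pre)
    also have "\<dots> = emeasure exp_law A * (emeasure clock_law (B 1) * emeasure clock_law (B 2))"
      using A B by (simp add: clock_pair.emeasure_pair_measure_Times clock_law.emeasure_pair_measure_Times)
    also have "\<dots> = (\<Prod>v\<in>J. emeasure exp_law (F v))"
      unfolding emA emB prod_J ..
    finally show "emeasure (distr ?P clock_law graft) ?E = (\<Prod>v\<in>J. emeasure exp_law (F v))" .
  qed (simp add: clock_law_def)
  then show ?thesis by (simp add: clock_law_def)
qed


section \<open>Leaves seen from the root\<close>

text \<open>
  The recursion follows the path from the root: a child sees the remaining time \<open>t - f []\<close> on a clock
  running \<open>\<alpha>\<close> times faster.  The requirement \<open>0 \<le> t\<close> at every vertex says that the path is still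
  alive there, so that no leaf exists at negative times, whatever the signs of the clocks.  This makes
  \<open>graft_in_leaf_event\<close> hold pointwise and not just almost surely; agreement with the defining sums
  for nonnegative clocks is \<open>is_leaf_iff\<close>.
\<close>

primrec is_leaf :: "real \<Rightarrow> nat list \<Rightarrow> real \<Rightarrow> (nat list \<Rightarrow> real) \<Rightarrow> bool" where
  "is_leaf \<alpha> [] t f \<longleftrightarrow> 0 \<le> t \<and> t < f []"
| "is_leaf \<alpha> (i # u) t f \<longleftrightarrow> 0 \<le> t \<and> is_leaf \<alpha> u (\<alpha> * (t - f [])) (\<lambda>v. f (i # v))"

lemma is_leaf_nonneg: "is_leaf \<alpha> v t f \<Longrightarrow> 0 \<le> t"
  by (cases v) auto

lemma sum_take_Cons:
  fixes f :: "nat list \<Rightarrow> real"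
  assumes "\<alpha> \<noteq> 0"
  shows "(\<Sum>j<Suc n. \<alpha> powi (- int j) * f (take j (i # u))) =
    f [] + (\<Sum>j<n. \<alpha> powi (- int j) * f (i # take j u)) / \<alpha>"
proof -
  have "\<alpha> powi (- int (Suc j)) = \<alpha> powi (- int j) / \<alpha>" for j
    using assms by (simp add: power_int_minus field_simps del: of_nat_Suc)
  then show ?thesis
    unfolding sum.lessThan_Suc_shift sum_divide_distrib by (simp del: of_nat_Suc)
qed

lemma is_leaf_iff:
  assumes \<alpha>: "\<alpha> > 0" and "v \<in> tree_vertices" and "0 \<le> t"
    and "\<And>v. v \<in> tree_vertices \<Longrightarrow> 0 \<le> f v"
  shows "is_leaf \<alpha> v t f \<longleftrightarrow>
    (\<Sum>j<length v. \<alpha> powi (- int j) * f (take j v)) \<le> t \<and>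
    t < (\<Sum>j\<le>length v. \<alpha> powi (- int j) * f (take j v))"
  using assms(2-)
proof (induction v arbitrary: t f)
  case Nil
  then show ?case by simp
next
  case (Cons i u)
  let ?s = "\<lambda>n. \<Sum>j<n. \<alpha> powi (- int j) * f (i # take j u)"
  have i: "i \<in> {1, 2}" and u: "u \<in> tree_vertices" using Cons.prems(1) by auto
  have "0 \<le> f []" using Cons.prems by simp
  have take: "take j u \<in> tree_vertices" for j
    using u set_take_subset[of j u] by (auto simp: tree_vertices_def in_lists_conv_set)
  have s0: "0 \<le> ?s n" for n
    using \<alpha> i take Cons.prems(3) by (intro sum_nonneg mult_nonneg_nonneg) auto
  have IH: "is_leaf \<alpha> u (\<alpha> * (t - f [])) (\<lambda>v. f (i # v)) \<longleftrightarrow>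
      ?s (length u) \<le> \<alpha> * (t - f []) \<and> \<alpha> * (t - f []) < ?s (Suc (length u))"
  proof (cases "f [] \<le> t")
    case True
    then have "0 \<le> \<alpha> * (t - f [])" using \<alpha> by simp
    then show ?thesis
      using Cons.IH[OF u, of "\<alpha> * (t - f [])" "\<lambda>v. f (i # v)"] i Cons.prems(3)
      by (auto simp: lessThan_Suc_atMost)
  next
    case False
    then have "\<alpha> * (t - f []) < 0" using \<alpha> by (simp add: mult_pos_neg)
    then show ?thesis using s0[of "length u"] is_leaf_nonneg by fastforce
  qed
  have scale: "?s n \<le> \<alpha> * (t - f []) \<longleftrightarrow> f [] + ?s n / \<alpha> \<le> t"
    "\<alpha> * (t - f []) < ?s n \<longleftrightarrow> t < f [] + ?s n / \<alpha>" for n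
    using \<alpha> by (auto simp: field_simps)
  show ?case
    using Cons.prems(2) IH \<alpha> unfolding scale
    by (simp add: lessThan_Suc_atMost[symmetric] sum_take_Cons del: take_Suc_Cons sum.lessThan_Suc)
qed

lemma measurable_child [measurable]:
  assumes "i \<in> {1, 2}"
  shows "(\<lambda>f v. f (i # v)) \<in> clock_law \<rightarrow>\<^sub>M clock_law"
proof -
  have "(\<lambda>f v. f (i # v)) \<in> clock_law \<rightarrow>\<^sub>M (\<Pi>\<^sub>M v\<in>tree_vertices. exp_law)"
    using assms by (intro measurable_PiM_single')
      (auto simp: space_clock_law extensional_def PiE_def intro: clock_component
        cong: measurable_cong_sets)
  then show ?thesis by (simp add: clock_law_def)
qed

text \<open>
  Joint measurability in the time and the clocks is needed, since the recursion evaluates the leaf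
  probability at a random time.
\<close>

lemma pred_is_leaf:
  assumes "v \<in> tree_vertices"
  shows "Measurable.pred (borel \<Otimes>\<^sub>M clock_law) (\<lambda>p. is_leaf \<alpha> v (fst p) (snd p))"
  using assms
proof (induction v)
  case Nil
  have [measurable]: "(\<lambda>p. snd p []) \<in> borel_measurable (borel \<Otimes>\<^sub>M clock_law)"
    by (rule measurable_compose[OF measurable_snd clock_component]) simp
  show ?case by simp
next
  case (Cons i u)
  have [measurable]: "(\<lambda>p. snd p []) \<in> borel_measurable (borel \<Otimes>\<^sub>M clock_law)"
    by (rule measurable_compose[OF measurable_snd clock_component]) simp
  have [measurable]: "(\<lambda>p v. snd p (i # v)) \<in> borel \<Otimes>\<^sub>M clock_law \<rightarrow>\<^sub>M clock_law"
    using Cons.prems by (intro measurable_compose[OF measurable_snd measurable_child]) auto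
  have "(\<lambda>p. (\<alpha> * (fst p - snd p []), \<lambda>v. snd p (i # v)))
      \<in> borel \<Otimes>\<^sub>M clock_law \<rightarrow>\<^sub>M borel \<Otimes>\<^sub>M clock_law"
    by measurable
  from measurable_compose[OF this Cons.IH] Cons.prems
  have [measurable]: "Measurable.pred (borel \<Otimes>\<^sub>M clock_law)
      (\<lambda>p. is_leaf \<alpha> u (\<alpha> * (fst p - snd p [])) (\<lambda>v. snd p (i # v)))"
    by simp
  show ?case by simp
qed

text \<open>
  Restricting the depth to a set \<open>N\<close> covers leaves of depth at least \<open>n\<close>, which decide
  finiteness of the set of leaves, and leaves of depth below \<open>n\<close>, which admit an inductive bound, with
  a single recursion.
\<close>

definition leaf_event :: "real \<Rightarrow> nat set \<Rightarrow> real \<Rightarrow> (nat list \<Rightarrow> real) set" where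
  "leaf_event \<alpha> N t =
     {f \<in> space clock_law. \<exists>v\<in>tree_vertices. length v \<in> N \<and> is_leaf \<alpha> v t f}"

definition leaf_prob :: "real \<Rightarrow> nat set \<Rightarrow> real \<Rightarrow> real" where
  "leaf_prob \<alpha> N t = measure clock_law (leaf_event \<alpha> N t)"

lemma pred_leaf_event:
  "Measurable.pred (borel \<Otimes>\<^sub>M clock_law)
     (\<lambda>p. \<exists>v\<in>tree_vertices. length v \<in> N \<and> is_leaf \<alpha> v (fst p) (snd p))"
  using pred_is_leaf by (intro pred_intros_countable_bounded pred_intros_logic) auto

lemma leaf_event_measurable [measurable]: "leaf_event \<alpha> N t \<in> sets clock_law"
proof -
  have "(\<lambda>f. (t, f)) \<in> clock_law \<rightarrow>\<^sub>M borel \<Otimes>\<^sub>M clock_law" by measurable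
  from measurable_compose[OF this pred_leaf_event[of N \<alpha>]]
  show ?thesis by (simp add: leaf_event_def pred_def)
qed

lemma leaf_prob_measurable [measurable]: "leaf_prob \<alpha> N \<in> borel_measurable borel"
proof -
  have "{p \<in> space (borel \<Otimes>\<^sub>M clock_law). snd p \<in> leaf_event \<alpha> N (fst p)} =
    {p \<in> space (borel \<Otimes>\<^sub>M clock_law). \<exists>v\<in>tree_vertices. length v \<in> N \<and> is_leaf \<alpha> v (fst p) (snd p)}"
    by (auto simp: leaf_event_def space_pair_measure)
  then have "(\<lambda>t. emeasure clock_law (leaf_event \<alpha> N t)) \<in> borel_measurable borel"
    using pred_leaf_event[of N \<alpha>]
    by (intro clock_law.measurable_emeasure) (auto simp: leaf_event_def pred_def)
  then show ?thesis unfolding leaf_prob_def measure_def by measurable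
qed

section \<open>The integral equation for the leaf probability\<close>

text \<open>
  The probability that at least one of two independent events of probability \<open>p\<close> occurs.
\<close>

definition either :: "real \<Rightarrow> real" where
  "either p = 1 - (1 - p)\<^sup>2"

lemma graft_child:
  assumes "f \<in> space clock_law" "g \<in> space clock_law"
  shows "(\<lambda>v. graft (x, f, g) (1 # v)) = f" "(\<lambda>v. graft (x, f, g) (2 # v)) = g"
  using assms by (auto simp: graft_def space_clock_law extensional_def fun_eq_iff)

lemma graft_in_leaf_event:
  assumes fg: "f \<in> space clock_law" "g \<in> space clock_law"
  shows "graft (x, f, g) \<in> leaf_event \<alpha> N t \<longleftrightarrow> 0 \<le> t \<and>
    (0 \<in> N \<and> t < x \<or> f \<in> leaf_event \<alpha> (Suc -` N) (\<alpha> * (t - x)) \<or>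
      g \<in> leaf_event \<alpha> (Suc -` N) (\<alpha> * (t - x)))"
proof -
  have root: "graft (x, f, g) [] = x" by (simp add: graft_def)
  have "graft (x, f, g) \<in> space clock_law" by (simp add: graft_def space_clock_law)
  then have "graft (x, f, g) \<in> leaf_event \<alpha> N t \<longleftrightarrow>
      (\<exists>v\<in>tree_vertices. length v \<in> N \<and> is_leaf \<alpha> v t (graft (x, f, g)))"
    by (simp add: leaf_event_def)
  also have "\<dots> \<longleftrightarrow> 0 \<in> N \<and> is_leaf \<alpha> [] t (graft (x, f, g)) \<or>
      (\<exists>u\<in>tree_vertices. Suc (length u) \<in> N \<and>
        (is_leaf \<alpha> (1 # u) t (graft (x, f, g)) \<or> is_leaf \<alpha> (2 # u) t (graft (x, f, g))))"
    (is "?L \<longleftrightarrow> ?R")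
  proof
    assume ?L
    then obtain v where v: "v \<in> tree_vertices" "length v \<in> N" "is_leaf \<alpha> v t (graft (x, f, g))"
      by auto
    then show ?R by (cases v) (auto simp del: is_leaf.simps)
  next
    assume ?R
    then show ?L
    proof (elim disjE conjE bexE)
      show ?L if "0 \<in> N" "is_leaf \<alpha> [] t (graft (x, f, g))"
        using that by (intro bexI[of _ "[]"]) auto
      show ?L if "u \<in> tree_vertices" "Suc (length u) \<in> N" "is_leaf \<alpha> (1 # u) t (graft (x, f, g))" for u
        using that by (intro bexI[of _ "1 # u"]) auto
      show ?L if "u \<in> tree_vertices" "Suc (length u) \<in> N" "is_leaf \<alpha> (2 # u) t (graft (x, f, g))" for u
        using that by (intro bexI[of _ "2 # u"]) auto
    qed
  qed
  also have "\<dots> \<longleftrightarrow> 0 \<le> t \<and>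
    (0 \<in> N \<and> t < x \<or> f \<in> leaf_event \<alpha> (Suc -` N) (\<alpha> * (t - x)) \<or>
      g \<in> leaf_event \<alpha> (Suc -` N) (\<alpha> * (t - x)))"
    unfolding is_leaf.simps root graft_child[OF fg] using fg by (auto simp: leaf_event_def)
  finally show ?thesis .
qed

lemma emeasure_either:
  assumes L: "L \<in> sets clock_law"
  shows "emeasure (clock_law \<Otimes>\<^sub>M clock_law)
      {(f, g). f \<in> space clock_law \<and> g \<in> space clock_law \<and> (f \<in> L \<or> g \<in> L)} =
    ennreal (either (measure clock_law L))"
proof -
  let ?C = "(space clock_law - L) \<times> (space clock_law - L)"
  have "{(f, g). f \<in> space clock_law \<and> g \<in> space clock_law \<and> (f \<in> L \<or> g \<in> L)} =
      space (clock_law \<Otimes>\<^sub>M clock_law) - ?C"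
    by (auto simp: space_pair_measure)
  moreover have "measure (clock_law \<Otimes>\<^sub>M clock_law) ?C = (1 - measure clock_law L)\<^sup>2"
    using L clock_law.prob_compl[OF L]
    by (simp add: measure_def clock_law.emeasure_pair_measure_Times enn2real_mult power2_eq_square)
  moreover have "?C \<in> sets (clock_law \<Otimes>\<^sub>M clock_law)" using L by auto
  ultimately show ?thesis
    by (simp add: clock_pair.P.prob_compl clock_pair.P.emeasure_eq_measure either_def)
qed

lemma leaf_event_neg: "t < 0 \<Longrightarrow> leaf_event \<alpha> N t = {}"
  using is_leaf_nonneg by (fastforce simp: leaf_event_def)

lemma emeasure_exp_law_gt: "0 \<le> t \<Longrightarrow> emeasure exp_law {t<..} = ennreal (exp (- t))"
proof -
  assume t: "0 \<le> t"
  have "distributed exp_law lborel (\<lambda>x. x) (exponential_density 1)"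
    by (auto simp: distributed_def exp_law_def distr_id2 intro!: distr_id2)
  from exp_law.exponential_distributedD_gt[OF this t] t show ?thesis
    by (simp add: exp_law.emeasure_eq_measure greaterThan_def)
qed

text \<open>
  Conditioning on the root clock \<open>x = t - s\<close>: the root itself is a leaf if \<open>x > t\<close>; otherwise the
  two subtrees are independent copies of the cascade observed at time \<open>\<alpha> * (t - x)\<close>, and depths
  drop by one.  The two alternatives exclude each other because the subtrees have no leaves at
  negative times.
\<close>

lemma leaf_prob_recursion:
  assumes \<alpha>: "\<alpha> > 0"
  shows "ennreal (leaf_prob \<alpha> N t) =
    (if 0 \<in> N \<and> 0 \<le> t then ennreal (exp (- t)) else 0) +
    (\<integral>\<^sup>+s. ennreal (exponential_density 1 (t - s)) *
      ennreal (either (leaf_prob \<alpha> (Suc -` N) (\<alpha> * s))) \<partial>lborel)"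
proof -
  let ?C = "clock_law \<Otimes>\<^sub>M clock_law"
  let ?L = "leaf_event \<alpha> N t" and ?L' = "\<lambda>x. leaf_event \<alpha> (Suc -` N) (\<alpha> * (t - x))"
  let ?Q = "\<lambda>x. leaf_prob \<alpha> (Suc -` N) (\<alpha> * (t - x))"
  let ?A = "graft -` ?L \<inter> space (exp_law \<Otimes>\<^sub>M ?C)"
  have A: "?A \<in> sets (exp_law \<Otimes>\<^sub>M ?C)" by measurable
  have "ennreal (leaf_prob \<alpha> N t) = emeasure (distr (exp_law \<Otimes>\<^sub>M ?C) clock_law graft) ?L"
    by (simp add: distr_graft leaf_prob_def clock_law.emeasure_eq_measure)
  also have "\<dots> = emeasure (exp_law \<Otimes>\<^sub>M ?C) ?A"
    by (rule emeasure_distr) auto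
  also have "\<dots> = (\<integral>\<^sup>+x. emeasure ?C (Pair x -` ?A) \<partial>exp_law)"
    using A by (rule clock_pair.emeasure_pair_measure_alt)
  also have "\<dots> = (\<integral>\<^sup>+x. ennreal (exponential_density 1 x) * emeasure ?C (Pair x -` ?A) \<partial>lborel)"
    using clock_pair.measurable_emeasure_Pair[OF A] unfolding exp_law_def
    by (intro nn_integral_density) (auto cong: measurable_cong_sets)
  also have "\<dots> = (\<integral>\<^sup>+x. ennreal (exponential_density 1 x) *
      (if 0 \<in> N \<and> 0 \<le> t then indicator {t<..} x else 0) +
      ennreal (exponential_density 1 x) * ennreal (either (?Q x)) \<partial>lborel)"
  proof (rule nn_integral_cong)
    fix x :: real
    have sec: "Pair x -` ?A = {(f, g). f \<in> space clock_law \<and> g \<in> space clock_law \<and>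
        (0 \<le> t \<and> (0 \<in> N \<and> t < x \<or> f \<in> ?L' x \<or> g \<in> ?L' x))}"
      by (auto simp: space_pair_measure graft_in_leaf_event)
    consider "x < 0" | "0 \<le> x" "t < 0" | "0 \<le> t" "t < x" | "0 \<le> x" "x \<le> t" by linarith
    \<comment> \<open>For \<open>x < 0\<close> the identity may fail, but there the density vanishes.\<close>
    then have "emeasure ?C (Pair x -` ?A) =
        (if 0 \<in> N \<and> 0 \<le> t then indicator {t<..} x else 0) + ennreal (either (?Q x)) \<or> x < 0"
    proof cases
      case 2
      then have "\<alpha> * (t - x) < 0" using \<alpha> by (simp add: mult_pos_neg)
      with 2 show ?thesis unfolding sec by (simp add: leaf_event_neg leaf_prob_def either_def)
    next
      case 3
      then have "\<alpha> * (t - x) < 0" using \<alpha> by (simp add: mult_pos_neg)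
      moreover have "{(f, g). f \<in> space clock_law \<and> g \<in> space clock_law} = space ?C"
        by (auto simp: space_pair_measure)
      ultimately show ?thesis using 3 clock_pair.P.emeasure_space_1 unfolding sec
        by (simp add: leaf_event_neg leaf_prob_def either_def)
    next
      case 4
      then show ?thesis unfolding sec
        using emeasure_either[OF leaf_event_measurable, of \<alpha> "Suc -` N" "\<alpha> * (t - x)"]
        by (simp add: leaf_prob_def)
    qed simp
    then show "ennreal (exponential_density 1 x) * emeasure ?C (Pair x -` ?A) =
      ennreal (exponential_density 1 x) * (if 0 \<in> N \<and> 0 \<le> t then indicator {t<..} x else 0) +
      ennreal (exponential_density 1 x) * ennreal (either (?Q x))"
      by (auto simp: exponential_density_def distrib_left)
  qed
  also have "\<dots> = (\<integral>\<^sup>+x. ennreal (exponential_density 1 x) *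
      (if 0 \<in> N \<and> 0 \<le> t then indicator {t<..} x else 0) \<partial>lborel) +
      (\<integral>\<^sup>+x. ennreal (exponential_density 1 x) * ennreal (either (?Q x)) \<partial>lborel)"
    by (intro nn_integral_add) (simp_all add: either_def)
  also have "(\<integral>\<^sup>+x. ennreal (exponential_density 1 x) *
      (if 0 \<in> N \<and> 0 \<le> t then indicator {t<..} x else 0) \<partial>lborel) =
      (if 0 \<in> N \<and> 0 \<le> t then ennreal (exp (- t)) else 0)"
  proof (cases "0 \<in> N \<and> 0 \<le> t")
    case True
    then have "(\<integral>\<^sup>+x. ennreal (exponential_density 1 x) * indicator {t<..} x \<partial>lborel) = emeasure exp_law {t<..}"
      unfolding exp_law_def by (subst emeasure_density) auto
    then show ?thesis using True emeasure_exp_law_gt[of t] by simp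
  next
    case False
    then show ?thesis by (auto simp only: if_False mult_zero_right nn_integral_const mult_zero_left)
  qed
  also have "(\<integral>\<^sup>+x. ennreal (exponential_density 1 x) * ennreal (either (?Q x)) \<partial>lborel) =
      (\<integral>\<^sup>+s. ennreal (exponential_density 1 (t - s)) *
        ennreal (either (leaf_prob \<alpha> (Suc -` N) (\<alpha> * s))) \<partial>lborel)"
    by (subst nn_integral_real_affine[where c = "-1" and t = t]) (simp_all add: either_def)
  finally show ?thesis .
qed

lemma leaf_prob_range: "0 \<le> leaf_prob \<alpha> N t" "leaf_prob \<alpha> N t \<le> 1"
  by (simp_all add: leaf_prob_def)

lemma leaf_prob_neg: "t < 0 \<Longrightarrow> leaf_prob \<alpha> N t = 0"
  by (simp add: leaf_prob_def leaf_event_neg)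

lemma leaf_prob_empty: "leaf_prob \<alpha> {} t = 0"
  by (simp add: leaf_prob_def leaf_event_def)

lemma leaf_event_mono: "N \<subseteq> N' \<Longrightarrow> leaf_event \<alpha> N t \<subseteq> leaf_event \<alpha> N' t"
  by (auto simp: leaf_event_def)

lemma either_eq: "either p = p * (2 - p)"
  by (simp add: either_def power2_eq_square algebra_simps)

lemma either_bounds:
  assumes "0 \<le> p" "p \<le> 1"
  shows "p \<le> either p" "either p \<le> 2 * p" "either p \<le> 1" "0 \<le> either p"
proof -
  have "p * 1 \<le> p * (2 - p)" using assms by (intro mult_left_mono) auto
  then show "p \<le> either p" by (simp add: either_eq)
  then show "0 \<le> either p" using assms by simp
  show "either p \<le> 2 * p" using assms by (simp add: either_eq algebra_simps)
  show "either p \<le> 1" by (simp add: either_def)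
qed

lemma either_measurable [measurable]: "either \<in> borel_measurable borel"
  unfolding either_def by measurable

lemma exponential_density_shift_integral:
  assumes "0 < l"
  shows "(\<integral>\<^sup>+s. ennreal (exponential_density l (t - s)) \<partial>lborel) = 1"
    "(\<integral>\<^sup>+s. ennreal (exponential_density l (s - t)) \<partial>lborel) = 1"
proof -
  interpret prob_space "density lborel (exponential_density l)"
    using assms by (rule prob_space_exponential_density)
  have 1: "(\<integral>\<^sup>+s. ennreal (exponential_density l s) \<partial>lborel) = 1"
    using emeasure_space_1 by (simp add: emeasure_density)
  show "(\<integral>\<^sup>+s. ennreal (exponential_density l (t - s)) \<partial>lborel) = 1"
    using nn_integral_real_affine[of "\<lambda>s. ennreal (exponential_density l s)" "-1" t] 1 by simp
  show "(\<integral>\<^sup>+s. ennreal (exponential_density l (s - t)) \<partial>lborel) = 1"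
    using nn_integral_real_affine[of "\<lambda>s. ennreal (exponential_density l s)" 1 "-t"] 1 by simp
qed

definition deep_prob :: "real \<Rightarrow> nat \<Rightarrow> real \<Rightarrow> real" where
  "deep_prob \<alpha> n = leaf_prob \<alpha> {n..}"

lemma deep_prob_range: "0 \<le> deep_prob \<alpha> n t" "deep_prob \<alpha> n t \<le> 1"
  by (simp_all add: deep_prob_def leaf_prob_range)

lemma deep_prob_neg: "t < 0 \<Longrightarrow> deep_prob \<alpha> n t = 0"
  by (simp add: deep_prob_def leaf_prob_neg)

lemma deep_prob_measurable [measurable]: "deep_prob \<alpha> n \<in> borel_measurable borel"
  by (simp add: deep_prob_def)

lemma deep_prob_antimono:
  assumes "m \<le> n"
  shows "deep_prob \<alpha> n t \<le> deep_prob \<alpha> m t"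
  unfolding deep_prob_def leaf_prob_def using assms
  by (intro clock_law.finite_measure_mono leaf_event_mono leaf_event_measurable) auto

lemma deep_prob_Suc:
  assumes "\<alpha> > 0"
  shows "ennreal (deep_prob \<alpha> (Suc n) t) =
    (\<integral>\<^sup>+s. ennreal (exponential_density 1 (t - s)) * ennreal (either (deep_prob \<alpha> n (\<alpha> * s))) \<partial>lborel)"
proof -
  have "Suc -` {Suc n..} = {n..}" by auto
  then show ?thesis
    using leaf_prob_recursion[OF assms, of "{Suc n..}" t] by (simp add: deep_prob_def)
qed

section \<open>Slow cascades: the scale factor is at most one\<close>

text \<open>
  For \<open>\<alpha> \<le> 1\<close> the argument \<open>\<alpha> * s\<close> in the recursion may be replaced by \<open>s\<close>, and the iterated integrals
  of \<open>2\<close> give the exponential series.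
\<close>

lemma deep_prob_le_power:
  assumes \<alpha>: "0 < \<alpha>" "\<alpha> \<le> 1" and "0 \<le> t"
  shows "deep_prob \<alpha> n t \<le> (2 * t) ^ n / fact n"
  using assms(3)
proof (induction n arbitrary: t)
  case 0
  then show ?case by (simp add: deep_prob_range)
next
  case (Suc n)
  let ?F = "\<lambda>s. (2 * s) ^ Suc n / fact (Suc n)" and ?f = "\<lambda>s. 2 * ((2 * s) ^ n / fact n) :: real"
  have "ennreal (deep_prob \<alpha> (Suc n) t) \<le> (\<integral>\<^sup>+s. ennreal (?f s) * indicator {0..t} s \<partial>lborel)"
    unfolding deep_prob_Suc[OF \<alpha>(1)]
  proof (rule nn_integral_mono)
    fix s :: real
    consider "s < 0" | "t < s" | "0 \<le> s" "s \<le> t" by linarith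
    then show "ennreal (exponential_density 1 (t - s)) * ennreal (either (deep_prob \<alpha> n (\<alpha> * s)))
      \<le> ennreal (?f s) * indicator {0..t} s"
    proof cases
      case 1
      then have "\<alpha> * s < 0" using \<alpha> by (simp add: mult_pos_neg)
      then show ?thesis by (simp add: deep_prob_neg either_def)
    next
      case 2
      then show ?thesis by (simp add: exponential_density_def)
    next
      case 3
      have "either (deep_prob \<alpha> n (\<alpha> * s)) \<le> 2 * deep_prob \<alpha> n (\<alpha> * s)"
        by (intro either_bounds deep_prob_range)
      also have "\<dots> \<le> 2 * ((2 * (\<alpha> * s)) ^ n / fact n)"
        using Suc.IH[of "\<alpha> * s"] \<alpha> 3 by simp
      also have "\<dots> \<le> ?f s"
        using \<alpha> 3 by (intro mult_left_mono divide_right_mono power_mono) (auto intro: mult_left_le_one_le)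
      finally have "exponential_density 1 (t - s) * either (deep_prob \<alpha> n (\<alpha> * s)) \<le> 1 * ?f s"
        using 3 either_bounds(4)[OF deep_prob_range]
        by (intro mult_mono) (auto simp: exponential_density_def)
      then show ?thesis using 3 by (simp add: ennreal_mult'[symmetric] exponential_density_def)
    qed
  qed
  also have "\<dots> = ennreal (?F t - ?F 0)"
  proof (rule nn_integral_FTC_Icc)
    fix s :: real assume s: "s \<in> {0..t}"
    have "DERIV (\<lambda>s. (2 * s) ^ Suc n) s :> real (Suc n) * (2 * s) ^ n * 2"
      using DERIV_power[OF DERIV_cmult_Id[of 2 s UNIV], of "Suc n"] by (simp add: mult_ac)
    from DERIV_cdivide[OF this, of "fact (Suc n)"]
    have "DERIV (\<lambda>s. (2 * s) ^ Suc n / fact (Suc n)) s :>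
      (real (Suc n) * (2 * s) ^ n * 2) / fact (Suc n)" .
    also have "(real (Suc n) * (2 * s) ^ n * 2) / fact (Suc n) = ?f s"
      by (simp add: field_simps del: of_nat_Suc)
    finally show "DERIV ?F s :> ?f s" .
    show "0 \<le> ?f s" using s by simp
  qed (use Suc.prems in auto)
  finally show ?case using Suc.prems by (simp add: ennreal_le_iff)
qed

lemma deep_prob_tendsto_0:
  assumes "0 < \<alpha>" "\<alpha> \<le> 1" "0 \<le> t"
  shows "(\<lambda>n. deep_prob \<alpha> n t) \<longlonglongrightarrow> 0"
proof (rule tendsto_sandwich[OF _ _ tendsto_const])
  have "summable (\<lambda>n. (2 * t) ^ n / fact n)"
    using summable_exp[of "2 * t"] by (simp add: divide_inverse mult.commute)
  then show "(\<lambda>n. (2 * t) ^ n / fact n) \<longlonglongrightarrow> 0" by (rule summable_LIMSEQ_zero)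
qed (use deep_prob_le_power[OF assms] deep_prob_range in auto)

section \<open>Fast cascades: the total mass is finite\<close>

text \<open>
  The bound \<open>min 1 (A * exp (- c * t))\<close> is a supersolution of the recursion.  With \<open>c * \<alpha> = 1 / 2\<close>,
  inserting the exponential gives at most \<open>exp (- t) + 4 * A * exp (- t / 2)\<close>.  As \<open>c < 1 / 2\<close>, the last
  term is smaller than \<open>A * exp (- c * t)\<close> by an exponential factor, which beats the constant
  \<open>4\<close> as soon as \<open>t\<close> exceeds some \<open>t0\<close>.  A large \<open>A\<close> makes the trivial bound \<open>1\<close> take over
  before \<open>t0\<close>.  The bound \<open>1\<close> itself solves the equation, so it has to be the
  iteration started from no leaves at all that is compared with the supersolution.
\<close>

lemma shallow_prob_exponential_bound:
  assumes \<alpha>: "1 < \<alpha>"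
  shows "\<exists>A c. 0 < A \<and> 0 < c \<and> (\<forall>n. \<forall>t\<ge>0. leaf_prob \<alpha> {..<n} t \<le> A * exp (- c * t))"
proof -
  \<comment> \<open>\<open>t0\<close> is the time at which \<open>4 * exp (- (1 / 2 - c) * t)\<close> has dropped to \<open>1 / 2\<close>.\<close>
  define c where "c = 1 / (2 * \<alpha>)"
  define t0 where "t0 = ln 8 / (1 / 2 - c)"
  define A where "A = 2 * exp (c * t0)"
  have c: "0 < c" "c < 1 / 2" and ca: "c * \<alpha> = 1 / 2" using \<alpha> by (auto simp: c_def field_simps)
  have t0: "0 < t0" "(1 / 2 - c) * t0 = ln 8" using c by (auto simp: t0_def)
  have A: "2 \<le> A" using t0 c by (simp add: A_def)
  have "leaf_prob \<alpha> {..<n} t \<le> A * exp (- c * t)" if "0 \<le> t" for n t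
    using that
  proof (induction n arbitrary: t)
    case 0
    then show ?case using A by (simp add: leaf_prob_empty)
  next
    case (Suc n)
    show ?case
    proof (cases "A * exp (- c * t) < 1")
      case False
      then show ?thesis using leaf_prob_range(2)[of \<alpha> "{..<Suc n}" t] by linarith
    next
      case True
      have "exp (c * (t0 - t)) < 1"
      proof -
        have "2 * exp (c * (t0 - t)) = A * exp (- c * t)"
          by (simp add: A_def exp_add[symmetric] algebra_simps)
        then show ?thesis using True by (smt (verit) exp_gt_zero)
      qed
      then have tt: "t0 < t" using c by (simp add: mult_less_0_iff)
      have "exp (- t / 2) = exp (- c * t) * exp (- ((1 / 2 - c) * t))"
        by (simp add: exp_add[symmetric] algebra_simps)
      also have "exp (- ((1 / 2 - c) * t)) \<le> exp (- ((1 / 2 - c) * t0))"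
        using tt c by simp
      also have "\<dots> = 1 / 8" using t0 by (simp add: exp_minus)
      finally have half: "4 * A * exp (- t / 2) \<le> A / 2 * exp (- c * t)"
        using A by (simp add: mult_left_mono)
      have "exp (- t) \<le> exp (- c * t)" using Suc.prems c mult_right_mono[of c 1 t] by simp
      also have "\<dots> \<le> A / 2 * exp (- c * t)" using A by simp
      finally have first: "exp (- t) \<le> A / 2 * exp (- c * t)" .
      have "Suc -` {..<Suc n} = {..<n}" by auto
      then have "ennreal (leaf_prob \<alpha> {..<Suc n} t) = ennreal (exp (- t)) +
         (\<integral>\<^sup>+s. ennreal (exponential_density 1 (t - s)) *
           ennreal (either (leaf_prob \<alpha> {..<n} (\<alpha> * s))) \<partial>lborel)"
        using leaf_prob_recursion[of \<alpha> "{..<Suc n}" t] \<alpha> Suc.prems by simp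
      also have "\<dots> \<le> ennreal (exp (- t)) +
         (\<integral>\<^sup>+s. ennreal (4 * A * exp (- t / 2)) * ennreal (exponential_density (1 / 2) (t - s)) \<partial>lborel)"
      proof (intro add_left_mono nn_integral_mono)
        fix s :: real
        consider "s < 0" | "t < s" | "0 \<le> s" "s \<le> t" by linarith
        then show "ennreal (exponential_density 1 (t - s)) * ennreal (either (leaf_prob \<alpha> {..<n} (\<alpha> * s)))
          \<le> ennreal (4 * A * exp (- t / 2)) * ennreal (exponential_density (1 / 2) (t - s))"
        proof cases
          case 1
          then have "\<alpha> * s < 0" using \<alpha> by (simp add: mult_pos_neg)
          then show ?thesis by (simp add: leaf_prob_neg either_def)
        next
          case 2
          then show ?thesis by (simp add: exponential_density_def)
        next
          case 3
          have "either (leaf_prob \<alpha> {..<n} (\<alpha> * s)) \<le> 2 * leaf_prob \<alpha> {..<n} (\<alpha> * s)"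
            by (intro either_bounds leaf_prob_range)
          also have "\<dots> \<le> 2 * (A * exp (- c * (\<alpha> * s)))"
            using Suc.IH[of "\<alpha> * s"] \<alpha> 3 by simp
          also have "- c * (\<alpha> * s) = - (s / 2)"
            using arg_cong[OF ca, of "\<lambda>r. r * s"] by (simp add: mult.assoc)
          finally have "exp (- (t - s)) * either (leaf_prob \<alpha> {..<n} (\<alpha> * s))
              \<le> exp (- (t - s)) * (2 * (A * exp (- (s / 2))))"
            by (intro mult_left_mono) auto
          also have "\<dots> = 4 * A * exp (- t / 2) * (1 / 2 * exp (- (t - s) * (1 / 2)))"
            by (simp add: exp_add[symmetric] algebra_simps add_divide_distrib[symmetric])
          finally show ?thesis using 3 A
            by (simp add: ennreal_mult'[symmetric] exponential_density_def)
        qed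
      qed
      also have "\<dots> = ennreal (exp (- t) + 4 * A * exp (- t / 2))"
        using A by (simp add: nn_integral_cmult exponential_density_shift_integral)
      finally have "leaf_prob \<alpha> {..<Suc n} t \<le> exp (- t) + 4 * A * exp (- t / 2)"
        using A by (subst (asm) ennreal_le_iff) auto
      then show ?thesis using half first by (simp add: field_simps)
    qed
  qed
  then show ?thesis using c A by (intro exI[of _ A] exI[of _ c]) auto
qed

text \<open>
  The exponential bound is uniform in the depth, so it survives the union over all depths.
\<close>

lemma finite_total_mass:
  assumes "1 < \<alpha>"
  shows "(\<integral>\<^sup>+t. ennreal (deep_prob \<alpha> 0 t) \<partial>lborel) < \<infinity>"
proof -
  obtain A c where Ac: "0 < c" "0 < A"
    and bound: "\<And>n t. 0 \<le> t \<Longrightarrow> leaf_prob \<alpha> {..<n} t \<le> A * exp (- c * t)"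
    using shallow_prob_exponential_bound[OF assms] by blast
  have le: "deep_prob \<alpha> 0 t \<le> A * exp (- c * t)" if "0 \<le> t" for t
  proof (rule LIMSEQ_le_const2)
    have "(\<lambda>n. leaf_prob \<alpha> {..<n} t) \<longlonglongrightarrow> measure clock_law (\<Union>n. leaf_event \<alpha> {..<n} t)"
      unfolding leaf_prob_def
      by (intro clock_law.finite_Lim_measure_incseq incseq_SucI leaf_event_mono) auto
    also have "(\<Union>n. leaf_event \<alpha> {..<n} t) = leaf_event \<alpha> {0..} t"
      by (auto simp: leaf_event_def)
    finally show "(\<lambda>n. leaf_prob \<alpha> {..<n} t) \<longlonglongrightarrow> deep_prob \<alpha> 0 t"
      by (simp add: deep_prob_def leaf_prob_def)
  qed (use bound that in auto)
  have "(\<integral>\<^sup>+t. ennreal (deep_prob \<alpha> 0 t) \<partial>lborel) \<le>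
      (\<integral>\<^sup>+t. ennreal (A / c) * ennreal (exponential_density c (t - 0)) \<partial>lborel)"
  proof (rule nn_integral_mono)
    fix t :: real
    show "ennreal (deep_prob \<alpha> 0 t) \<le> ennreal (A / c) * ennreal (exponential_density c (t - 0))"
    proof (cases "t < 0")
      case False
      then have "deep_prob \<alpha> 0 t \<le> A / c * exponential_density c (t - 0)"
        using le[of t] Ac by (simp add: exponential_density_def mult.commute)
      then have "ennreal (deep_prob \<alpha> 0 t) \<le> ennreal (A / c * exponential_density c (t - 0))"
        by (rule ennreal_leI)
      also have "\<dots> = ennreal (A / c) * ennreal (exponential_density c (t - 0))"
        using Ac by (intro ennreal_mult') auto
      finally show ?thesis .
    qed (simp add: deep_prob_neg)
  qed
  also have "\<dots> = ennreal (A / c)"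
    using exponential_density_shift_integral(2)[of c 0] Ac by (simp add: nn_integral_cmult)
  also have "\<dots> < \<infinity>" by simp
  finally show ?thesis .
qed

definition mass :: "(real \<Rightarrow> real) \<Rightarrow> ennreal" where
  "mass q = (\<integral>\<^sup>+t. ennreal (q t) \<partial>lborel)"

lemma nn_integral_stretch:
  assumes [measurable]: "g \<in> borel_measurable borel" and "0 < \<alpha>"
  shows "ennreal \<alpha> * (\<integral>\<^sup>+s. g (\<alpha> * s) \<partial>lborel) = (\<integral>\<^sup>+s. g s \<partial>lborel)"
  using nn_integral_real_affine[of g \<alpha> 0] assms by simp

text \<open>
  The exponential kernel has integral one in \<open>t\<close>, so Tonelli leaves only the dilation by \<open>\<alpha>\<close>.  This
  balance is what makes \<open>\<alpha> = 2\<close> critical: \<open>either p\<close> is close to \<open>2 * p\<close> for small \<open>p\<close>.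
\<close>

lemma mass_deep_Suc:
  assumes \<alpha>: "0 < \<alpha>"
  shows "ennreal \<alpha> * mass (deep_prob \<alpha> (Suc n)) = mass (\<lambda>t. either (deep_prob \<alpha> n t))"
proof -
  have "mass (deep_prob \<alpha> (Suc n)) = (\<integral>\<^sup>+t. \<integral>\<^sup>+s. ennreal (exponential_density 1 (t - s)) *
      ennreal (either (deep_prob \<alpha> n (\<alpha> * s))) \<partial>lborel \<partial>lborel)"
    by (simp add: mass_def deep_prob_Suc[OF \<alpha>])
  also have "\<dots> = (\<integral>\<^sup>+s. \<integral>\<^sup>+t. ennreal (exponential_density 1 (t - s)) *
      ennreal (either (deep_prob \<alpha> n (\<alpha> * s))) \<partial>lborel \<partial>lborel)"
    by (rule lborel_pair.Fubini') measurable
  also have "\<dots> = (\<integral>\<^sup>+s. ennreal (either (deep_prob \<alpha> n (\<alpha> * s))) \<partial>lborel)"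
    by (simp add: nn_integral_multc exponential_density_shift_integral)
  finally show ?thesis
    using nn_integral_stretch[of "\<lambda>s. ennreal (either (deep_prob \<alpha> n s))" \<alpha>] \<alpha>
    by (simp add: mass_def)
qed

text \<open>
  Since the kernel is bounded by one, the mass of one generation controls the next one uniformly in
  time.  This turns convergence of integrals into pointwise and uniform convergence.
\<close>

lemma deep_prob_le_mass:
  assumes \<alpha>: "0 < \<alpha>"
  shows "ennreal (\<alpha> * deep_prob \<alpha> (Suc n) t) \<le> 2 * mass (deep_prob \<alpha> n)"
proof -
  have "ennreal (deep_prob \<alpha> (Suc n) t) \<le> (\<integral>\<^sup>+s. ennreal (2 * deep_prob \<alpha> n (\<alpha> * s)) \<partial>lborel)"
    unfolding deep_prob_Suc[OF \<alpha>]
  proof (rule nn_integral_mono)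
    fix s
    have "exponential_density 1 (t - s) * either (deep_prob \<alpha> n (\<alpha> * s)) \<le> 1 * (2 * deep_prob \<alpha> n (\<alpha> * s))"
      by (intro mult_mono either_bounds deep_prob_range) (auto simp: exponential_density_def)
    then show "ennreal (exponential_density 1 (t - s)) * ennreal (either (deep_prob \<alpha> n (\<alpha> * s)))
      \<le> ennreal (2 * deep_prob \<alpha> n (\<alpha> * s))"
      by (subst ennreal_mult'[symmetric]) (simp_all add: exponential_density_nonneg ennreal_leI)
  qed
  also have "\<dots> = 2 * (\<integral>\<^sup>+s. ennreal (deep_prob \<alpha> n (\<alpha> * s)) \<partial>lborel)"
    by (simp add: ennreal_mult' nn_integral_cmult)
  finally have "ennreal \<alpha> * ennreal (deep_prob \<alpha> (Suc n) t) \<le>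
      2 * (ennreal \<alpha> * (\<integral>\<^sup>+s. ennreal (deep_prob \<alpha> n (\<alpha> * s)) \<partial>lborel))"
    using mult_left_mono[of _ _ "ennreal \<alpha>"] by (simp add: mult.left_commute)
  then show ?thesis
    using nn_integral_stretch[of "\<lambda>s. ennreal (deep_prob \<alpha> n s)" \<alpha>] \<alpha>
    by (simp add: mass_def ennreal_mult')
qed

section \<open>The probability of leaves at all depths\<close>

definition endless_prob :: "real \<Rightarrow> real \<Rightarrow> real" where
  "endless_prob \<alpha> t = measure clock_law (\<Inter>n. leaf_event \<alpha> {n..} t)"

lemma deep_prob_tendsto: "(\<lambda>n. deep_prob \<alpha> n t) \<longlonglongrightarrow> endless_prob \<alpha> t"
  unfolding deep_prob_def leaf_prob_def endless_prob_def
  by (intro clock_law.finite_Lim_measure_decseq decseq_SucI leaf_event_mono) auto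

lemma endless_prob_range: "0 \<le> endless_prob \<alpha> t" "endless_prob \<alpha> t \<le> 1"
  by (simp_all add: endless_prob_def)

lemma endless_prob_measurable [measurable]: "endless_prob \<alpha> \<in> borel_measurable borel"
  using deep_prob_tendsto by (rule borel_measurable_LIMSEQ_real) measurable

lemma either_tendsto: "p \<longlonglongrightarrow> x \<Longrightarrow> (\<lambda>n. either (p n)) \<longlonglongrightarrow> either x"
  unfolding either_def by (intro tendsto_intros)

lemma endless_prob_fixed_point:
  assumes \<alpha>: "0 < \<alpha>"
  shows "ennreal (endless_prob \<alpha> t) =
    (\<integral>\<^sup>+s. ennreal (exponential_density 1 (t - s)) * ennreal (either (endless_prob \<alpha> (\<alpha> * s))) \<partial>lborel)"
proof (rule LIMSEQ_unique)
  show "(\<lambda>n. ennreal (deep_prob \<alpha> (Suc n) t)) \<longlonglongrightarrow> ennreal (endless_prob \<alpha> t)"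
    using deep_prob_tendsto by (intro tendsto_ennrealI LIMSEQ_Suc)
  show "(\<lambda>n. ennreal (deep_prob \<alpha> (Suc n) t)) \<longlonglongrightarrow>
    (\<integral>\<^sup>+s. ennreal (exponential_density 1 (t - s)) * ennreal (either (endless_prob \<alpha> (\<alpha> * s))) \<partial>lborel)"
    unfolding deep_prob_Suc[OF \<alpha>]
  proof (rule nn_integral_dominated_convergence)
    show "(\<integral>\<^sup>+s. ennreal (exponential_density 1 (t - s)) \<partial>lborel) < \<infinity>"
      by (simp add: exponential_density_shift_integral)
    show "AE s in lborel. ennreal (exponential_density 1 (t - s)) * ennreal (either (deep_prob \<alpha> n (\<alpha> * s)))
        \<le> ennreal (exponential_density 1 (t - s))" for n
    proof (rule AE_I2)
      fix s
      have "ennreal (either (deep_prob \<alpha> n (\<alpha> * s))) \<le> 1"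
        using either_bounds(3)[OF deep_prob_range] by simp
      then show "ennreal (exponential_density 1 (t - s)) * ennreal (either (deep_prob \<alpha> n (\<alpha> * s)))
        \<le> ennreal (exponential_density 1 (t - s))"
        using mult_left_mono[of _ 1 "ennreal (exponential_density 1 (t - s))"] by simp
    qed
    show "AE s in lborel. (\<lambda>n. ennreal (exponential_density 1 (t - s)) * ennreal (either (deep_prob \<alpha> n (\<alpha> * s))))
      \<longlonglongrightarrow> ennreal (exponential_density 1 (t - s)) * ennreal (either (endless_prob \<alpha> (\<alpha> * s)))"
      by (intro AE_I2 ennreal_tendsto_cmult tendsto_ennrealI either_tendsto deep_prob_tendsto) simp
  qed measurable
qed

lemma mass_deep_tendsto:
  assumes "1 < \<alpha>"
  shows "(\<lambda>n. mass (deep_prob \<alpha> n)) \<longlonglongrightarrow> mass (endless_prob \<alpha>)"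
    and "(\<lambda>n. mass (\<lambda>t. either (deep_prob \<alpha> n t))) \<longlonglongrightarrow> mass (\<lambda>t. either (endless_prob \<alpha> t))"
proof -
  show "(\<lambda>n. mass (deep_prob \<alpha> n)) \<longlonglongrightarrow> mass (endless_prob \<alpha>)"
    unfolding mass_def
    by (rule nn_integral_dominated_convergence[where w = "\<lambda>t. ennreal (deep_prob \<alpha> 0 t)"])
      (auto intro!: tendsto_ennrealI deep_prob_tendsto finite_total_mass[OF assms] ennreal_leI deep_prob_antimono
        simp del: infinity_ennreal_def)
  have "(\<integral>\<^sup>+t. ennreal (2 * deep_prob \<alpha> 0 t) \<partial>lborel) < \<infinity>"
    using finite_total_mass[OF assms] by (simp add: ennreal_mult' nn_integral_cmult ennreal_mult_less_top)
  moreover have "either (deep_prob \<alpha> n t) \<le> 2 * deep_prob \<alpha> 0 t" for n t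
    using either_bounds(2)[OF deep_prob_range, of \<alpha> n t] deep_prob_antimono[of 0 n \<alpha> t] by simp
  ultimately show "(\<lambda>n. mass (\<lambda>t. either (deep_prob \<alpha> n t))) \<longlonglongrightarrow> mass (\<lambda>t. either (endless_prob \<alpha> t))"
    unfolding mass_def
    by (intro nn_integral_dominated_convergence[where w = "\<lambda>t. ennreal (2 * deep_prob \<alpha> 0 t)"])
      (auto intro!: tendsto_ennrealI either_tendsto deep_prob_tendsto ennreal_leI
        simp del: infinity_ennreal_def)
qed

lemma mass_endless:
  assumes \<alpha>: "1 < \<alpha>"
  shows "ennreal \<alpha> * mass (endless_prob \<alpha>) = mass (\<lambda>t. either (endless_prob \<alpha> t))"
proof (rule LIMSEQ_unique)
  show "(\<lambda>n. ennreal \<alpha> * mass (deep_prob \<alpha> (Suc n))) \<longlonglongrightarrow> ennreal \<alpha> * mass (endless_prob \<alpha>)"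
    using mass_deep_tendsto(1)[OF \<alpha>] by (intro ennreal_tendsto_cmult LIMSEQ_Suc) auto
  show "(\<lambda>n. ennreal \<alpha> * mass (deep_prob \<alpha> (Suc n))) \<longlonglongrightarrow> mass (\<lambda>t. either (endless_prob \<alpha> t))"
    using mass_deep_Suc[of \<alpha>] mass_deep_tendsto(2)[OF \<alpha>] \<alpha> by simp
qed

lemma mass_endless_finite:
  assumes "1 < \<alpha>"
  shows "mass (endless_prob \<alpha>) < \<infinity>"
proof -
  have "endless_prob \<alpha> t \<le> deep_prob \<alpha> 0 t" for t
    using deep_prob_tendsto by (rule LIMSEQ_le_const2) (auto intro: deep_prob_antimono)
  then have "mass (endless_prob \<alpha>) \<le> mass (deep_prob \<alpha> 0)"
    unfolding mass_def by (intro nn_integral_mono ennreal_leI)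
  then show ?thesis using finite_total_mass[OF assms] unfolding mass_def by simp
qed

section \<open>No endless crossings when the scale factor is at least two\<close>

lemma endless_prob_eq_0:
  assumes \<alpha>: "2 \<le> \<alpha>"
  shows "endless_prob \<alpha> t = 0"
proof -
  let ?w = "endless_prob \<alpha>"
  have \<alpha>1: "1 < \<alpha>" using \<alpha> by simp
  \<comment> \<open>The balance \<open>\<alpha> * \<integral> w + \<integral> w\<^sup>2 = 2 * \<integral> w\<close>; as \<open>2 \<le> \<alpha>\<close> and \<open>\<integral> w\<close> is finite, \<open>\<integral> w\<^sup>2\<close> vanishes.\<close>
  have "ennreal (either (?w t)) + ennreal ((?w t)\<^sup>2) = ennreal (2 * ?w t)" for t
    using either_bounds(4)[OF endless_prob_range, of \<alpha> t]
    by (subst ennreal_plus[symmetric]) (auto simp: either_eq power2_eq_square algebra_simps)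
  then have "mass (\<lambda>t. either (?w t)) + mass (\<lambda>t. (?w t)\<^sup>2) = mass (\<lambda>t. 2 * ?w t)"
    unfolding mass_def by (subst nn_integral_add[symmetric]) auto
  also have "mass (\<lambda>t. 2 * ?w t) = 2 * mass ?w"
    by (simp add: mass_def ennreal_mult' nn_integral_cmult)
  finally have "ennreal \<alpha> * mass ?w + mass (\<lambda>t. (?w t)\<^sup>2) = 2 * mass ?w"
    by (simp add: mass_endless[OF \<alpha>1])
  also have "\<dots> \<le> ennreal \<alpha> * mass ?w"
    using \<alpha> ennreal_leI[of 2 \<alpha>] by (intro mult_right_mono) auto
  finally have "ennreal \<alpha> * mass ?w + mass (\<lambda>t. (?w t)\<^sup>2) \<le> ennreal \<alpha> * mass ?w + 0" by simp
  then have "ennreal \<alpha> * mass ?w = \<infinity> \<or> mass (\<lambda>t. (?w t)\<^sup>2) \<le> 0"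
    by (rule iffD1[OF ennreal_add_left_cancel_le])
  moreover have "ennreal \<alpha> * mass ?w < \<infinity>"
    using mass_endless_finite[OF \<alpha>1] by (simp add: ennreal_mult_less_top)
  ultimately have "mass (\<lambda>t. (?w t)\<^sup>2) = 0" by auto
  then have "AE t in lborel. ennreal ((?w t)\<^sup>2) = 0"
    unfolding mass_def by (subst (asm) nn_integral_0_iff_AE) auto
  then have "AE t in lborel. ?w t = 0"
    by eventually_elim (simp add: ennreal_eq_0_iff)
  then have "mass ?w = 0"
    unfolding mass_def by (subst nn_integral_0_iff_AE) auto
  \<comment> \<open>Almost everywhere is improved to everywhere by the uniform bound through the mass.\<close>
  then have bound: "(\<lambda>n. 2 * mass (deep_prob \<alpha> n)) \<longlonglongrightarrow> 2 * 0"
    using mass_deep_tendsto(1)[OF \<alpha>1] by (intro ennreal_tendsto_cmult) auto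
  have "(\<lambda>n. ennreal (\<alpha> * deep_prob \<alpha> (Suc n) t)) \<longlonglongrightarrow> ennreal (\<alpha> * ?w t)"
    using deep_prob_tendsto by (intro tendsto_ennrealI tendsto_mult tendsto_const LIMSEQ_Suc)
  then have "ennreal (\<alpha> * ?w t) \<le> 2 * 0"
    by (rule LIMSEQ_le[OF _ bound]) (use deep_prob_le_mass \<alpha>1 in auto)
  then show ?thesis
    using \<alpha> endless_prob_range(1)[of \<alpha> t] by (simp add: ennreal_eq_0_iff mult_le_0_iff)
qed

section \<open>Endless crossings when the scale factor is between one and two\<close>

lemma mass_deep_pos:
  assumes \<alpha>: "0 < \<alpha>"
  shows "0 < mass (deep_prob \<alpha> n)"
proof (induction n)
  case 0
  have "exp (- 1) \<le> deep_prob \<alpha> 0 t" if "t \<in> {0..1}" for t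
  proof -
    have "ennreal (exp (- t)) \<le> ennreal (deep_prob \<alpha> 0 t)"
      using leaf_prob_recursion[OF \<alpha>, of "{0..}" t] that by (simp add: deep_prob_def)
    then have "exp (- t) \<le> deep_prob \<alpha> 0 t"
      by (subst (asm) ennreal_le_iff) (auto simp: deep_prob_range)
    moreover have "exp (- 1) \<le> exp (- t)" using that by simp
    ultimately show ?thesis by linarith
  qed
  then have "ennreal (exp (- 1)) * indicator {0..1} t \<le> ennreal (deep_prob \<alpha> 0 t)" for t :: real
    by (auto split: split_indicator intro!: ennreal_leI)
  then have "(\<integral>\<^sup>+t. ennreal (exp (- 1)) * indicator {0..1::real} t \<partial>lborel) \<le> mass (deep_prob \<alpha> 0)"
    unfolding mass_def by (rule nn_integral_mono)
  then have "ennreal (exp (- 1)) \<le> mass (deep_prob \<alpha> 0)"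
    by (simp add: nn_integral_cmult_indicator)
  then show ?case by (rule less_le_trans[rotated]) simp
next
  case (Suc n)
  have "mass (deep_prob \<alpha> n) \<le> mass (\<lambda>t. either (deep_prob \<alpha> n t))"
    unfolding mass_def by (intro nn_integral_mono ennreal_leI either_bounds deep_prob_range)
  with Suc have "0 < ennreal \<alpha> * mass (deep_prob \<alpha> (Suc n))"
    unfolding mass_deep_Suc[OF \<alpha>] by simp
  then show ?case by (simp add: zero_less_iff_neq_zero)
qed

text \<open>
  If the limit were zero, the leaf probabilities would become uniformly small, and small probabilities
  are amplified by the factor \<open>2 / \<alpha> > 1\<close>, up to a negligible quadratic loss: the masses could
  not tend to zero.
\<close>

lemma endless_prob_not_identically_0:
  assumes \<alpha>: "1 < \<alpha>" "\<alpha> < 2"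
  shows "\<exists>r. endless_prob \<alpha> r > 0"
proof (rule ccontr)
  assume "\<not> ?thesis"
  then have "\<not> 0 < endless_prob \<alpha> r" for r by blast
  then have w0: "endless_prob \<alpha> r = 0" for r
    using endless_prob_range(1)[of \<alpha> r] by (metis order_le_less)
  have lim: "(\<lambda>n. mass (deep_prob \<alpha> n)) \<longlonglongrightarrow> 0"
    using mass_deep_tendsto(1)[OF \<alpha>(1)] by (simp add: mass_def w0)
  then have "(\<lambda>n. 2 * mass (deep_prob \<alpha> n)) \<longlonglongrightarrow> 2 * 0"
    by (intro ennreal_tendsto_cmult) auto
  then have "\<forall>\<^sub>F n in sequentially. 2 * mass (deep_prob \<alpha> n) < ennreal (2 - \<alpha>)"
    using \<alpha> by (intro order_tendstoD) auto
  then obtain n0 where n0: "\<And>n. n0 \<le> n \<Longrightarrow> 2 * mass (deep_prob \<alpha> n) < ennreal (2 - \<alpha>)"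
    unfolding eventually_sequentially by blast
  have grow: "mass (deep_prob \<alpha> (Suc n0)) \<le> mass (deep_prob \<alpha> (Suc n0 + k))" for k
  proof (induction k)
    case (Suc k)
    let ?n = "n0 + k"
    \<comment> \<open>Below \<open>2 - \<alpha>\<close> the reproduction factor \<open>2 - p\<close> is at least \<open>\<alpha>\<close>.\<close>
    have small: "deep_prob \<alpha> (Suc ?n) t \<le> 2 - \<alpha>" for t
    proof -
      have "ennreal (\<alpha> * deep_prob \<alpha> (Suc ?n) t) < ennreal (2 - \<alpha>)"
        using deep_prob_le_mass[of \<alpha> ?n t] n0[of ?n] \<alpha> by simp
      then have "\<alpha> * deep_prob \<alpha> (Suc ?n) t < 2 - \<alpha>"
        using \<alpha> deep_prob_range(1)[of \<alpha> "Suc ?n" t] by (subst (asm) ennreal_less_iff) auto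
      moreover have "1 * deep_prob \<alpha> (Suc ?n) t \<le> \<alpha> * deep_prob \<alpha> (Suc ?n) t"
        using \<alpha> by (intro mult_right_mono deep_prob_range) auto
      ultimately show ?thesis by simp
    qed
    have "\<alpha> * deep_prob \<alpha> (Suc ?n) t \<le> either (deep_prob \<alpha> (Suc ?n) t)" for t
      unfolding either_eq mult.commute[of \<alpha>] using small[of t]
      by (intro mult_left_mono deep_prob_range) auto
    then have "mass (\<lambda>t. \<alpha> * deep_prob \<alpha> (Suc ?n) t) \<le> mass (\<lambda>t. either (deep_prob \<alpha> (Suc ?n) t))"
      unfolding mass_def by (intro nn_integral_mono ennreal_leI)
    also have "\<dots> = ennreal \<alpha> * mass (deep_prob \<alpha> (Suc (Suc ?n)))"
      using \<alpha> by (simp add: mass_deep_Suc)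
    also have "mass (\<lambda>t. \<alpha> * deep_prob \<alpha> (Suc ?n) t) = ennreal \<alpha> * mass (deep_prob \<alpha> (Suc ?n))"
      using \<alpha> by (simp add: mass_def ennreal_mult' nn_integral_cmult)
    finally have "mass (deep_prob \<alpha> (Suc ?n)) \<le> mass (deep_prob \<alpha> (Suc (Suc ?n)))"
      using \<alpha> by (simp add: ennreal_mult_le_mult_iff)
    then show ?case using Suc.IH by simp
  qed simp
  have "mass (deep_prob \<alpha> (Suc n0)) \<le> 0"
  proof (rule LIMSEQ_le_const)
    show "(\<lambda>k. mass (deep_prob \<alpha> (k + Suc n0))) \<longlonglongrightarrow> 0"
      using lim by (rule LIMSEQ_ignore_initial_segment)
  qed (use grow in \<open>auto simp: add.commute\<close>)
  then show False using mass_deep_pos[of \<alpha> "Suc n0"] \<alpha> by simp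
qed

text \<open>
  The kernel \<open>exp (- (t - s))\<close> picks up the factor \<open>exp (- (t - r))\<close> when \<open>r\<close> is moved to \<open>t\<close>, and the
  domain of integration only grows.
\<close>

lemma endless_prob_growth:
  assumes \<alpha>: "0 < \<alpha>" and "r \<le> t"
  shows "exp (- (t - r)) * endless_prob \<alpha> r \<le> endless_prob \<alpha> t"
proof -
  have "ennreal (exp (- (t - r))) * ennreal (endless_prob \<alpha> r) =
    (\<integral>\<^sup>+s. ennreal (exp (- (t - r))) * (ennreal (exponential_density 1 (r - s)) *
      ennreal (either (endless_prob \<alpha> (\<alpha> * s)))) \<partial>lborel)"
    unfolding endless_prob_fixed_point[OF \<alpha>, of r] by (rule nn_integral_cmult[symmetric]) measurable
  also have "\<dots> \<le> ennreal (endless_prob \<alpha> t)"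
    unfolding endless_prob_fixed_point[OF \<alpha>, of t]
  proof (rule nn_integral_mono)
    fix s
    have "exp (- (t - r)) * exponential_density 1 (r - s) \<le> exponential_density 1 (t - s)"
      using assms(2) by (auto simp: exponential_density_def exp_add[symmetric])
    then have "ennreal (exp (- (t - r))) * ennreal (exponential_density 1 (r - s)) \<le>
        ennreal (exponential_density 1 (t - s))"
      by (subst ennreal_mult'[symmetric]) (auto intro: ennreal_leI)
    then show "ennreal (exp (- (t - r))) * (ennreal (exponential_density 1 (r - s)) *
        ennreal (either (endless_prob \<alpha> (\<alpha> * s)))) \<le>
      ennreal (exponential_density 1 (t - s)) * ennreal (either (endless_prob \<alpha> (\<alpha> * s)))"
      by (simp add: mult.assoc[symmetric] mult_right_mono)
  qed
  finally show ?thesis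
    by (subst (asm) ennreal_mult'[symmetric]) (auto simp: ennreal_le_iff endless_prob_range)
qed

text \<open>
  Positivity at \<open>r\<close> persists on all of \<open>{r..\<alpha> * t}\<close> by \<open>endless_prob_growth\<close>, so the fixed point equation
  at \<open>t\<close> integrates a function bounded below by a positive constant \<open>k\<close> over \<open>{r / \<alpha>..t}\<close>.
\<close>

lemma endless_prob_spreads_down:
  assumes \<alpha>: "0 < \<alpha>" and r: "endless_prob \<alpha> r > 0" "r < \<alpha> * t"
  shows "endless_prob \<alpha> t > 0"
proof -
  let ?w = "endless_prob \<alpha>"
  define k where "k = exp (- (t - r / \<alpha>)) * (exp (- (\<alpha> * t - r)) * ?w r)"
  have rt: "r / \<alpha> < t" using \<alpha> r by (simp add: field_simps)
  have "(\<integral>\<^sup>+s. ennreal k * indicator {r / \<alpha>..t} s \<partial>lborel) \<le> ennreal (?w t)"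
    unfolding endless_prob_fixed_point[OF \<alpha>, of t]
  proof (rule nn_integral_mono)
    fix s
    show "ennreal k * indicator {r / \<alpha>..t} s \<le>
      ennreal (exponential_density 1 (t - s)) * ennreal (either (?w (\<alpha> * s)))"
    proof (cases "s \<in> {r / \<alpha>..t}")
      case True
      then have s: "r \<le> \<alpha> * s" "\<alpha> * s \<le> \<alpha> * t" "r / \<alpha> \<le> s" "s \<le> t" using \<alpha> by (auto simp: field_simps)
      have "exp (- (\<alpha> * t - r)) * ?w r \<le> exp (- (\<alpha> * s - r)) * ?w r"
        using s r by (intro mult_right_mono) auto
      also have "\<dots> \<le> ?w (\<alpha> * s)" using s by (intro endless_prob_growth \<alpha>)
      also have "\<dots> \<le> either (?w (\<alpha> * s))" by (intro either_bounds endless_prob_range)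
      finally have "k \<le> exp (- (t - s)) * either (?w (\<alpha> * s))"
        unfolding k_def using s r by (intro mult_mono) auto
      also have "\<dots> = exponential_density 1 (t - s) * either (?w (\<alpha> * s))"
        using s by (simp add: exponential_density_def)
      finally show ?thesis
        using True by (subst ennreal_mult'[symmetric]) (auto intro!: ennreal_leI simp: exponential_density_nonneg)
    qed simp
  qed
  moreover have "0 < k" using r by (simp add: k_def)
  ultimately have "ennreal (k * (t - r / \<alpha>)) \<le> ennreal (?w t)"
    using rt by (simp add: nn_integral_cmult_indicator ennreal_mult')
  then have "k * (t - r / \<alpha>) \<le> ?w t"
    by (subst (asm) ennreal_le_iff) (auto simp: endless_prob_range)
  moreover have "0 < k * (t - r / \<alpha>)" using \<open>0 < k\<close> rt by simp
  ultimately show ?thesis by linarith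
qed

text \<open>
  Starting from a time \<open>R\<close> with positive probability, the times \<open>R / b ^ n\<close> have it too for any fixed
  \<open>1 < b < \<alpha>\<close>, and they tend to zero; growth then reaches every positive time.
\<close>

lemma endless_prob_pos:
  assumes \<alpha>: "1 < \<alpha>" "\<alpha> < 2" and t: "0 < t"
  shows "endless_prob \<alpha> t > 0"
proof -
  obtain r where r: "endless_prob \<alpha> r > 0" using endless_prob_not_identically_0[OF \<alpha>] by blast
  \<comment> \<open>The iteration needs a positive starting time, while \<open>r\<close> is only known to exist.\<close>
  define R where "R = \<bar>r\<bar> + 1"
  define b where "b = (1 + \<alpha>) / 2"
  have b: "1 < b" "b < \<alpha>" using \<alpha> by (auto simp: b_def)
  have R: "0 < R" "r < R" by (auto simp: R_def)
  have pos: "endless_prob \<alpha> (R / b ^ n) > 0" for n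
  proof (induction n)
    case 0
    have "0 < exp (- (R - r)) * endless_prob \<alpha> r" using r by simp
    then show ?case using endless_prob_growth[of \<alpha> r R] R \<alpha> by simp
  next
    case (Suc n)
    have "R / b ^ n = b * (R / b ^ Suc n)" using b by (simp add: field_simps)
    also have "\<dots> < \<alpha> * (R / b ^ Suc n)" using b R by (intro mult_strict_right_mono) auto
    finally have "R / b ^ n < \<alpha> * (R / b ^ Suc n)" .
    then show ?case using endless_prob_spreads_down[OF _ Suc.IH] \<alpha> by simp
  qed
  obtain n where n: "R / t < b ^ n" using real_arch_pow[OF b(1)] by blast
  then have "R / b ^ n \<le> t" using t b by (simp add: field_simps)
  then have "exp (- (t - R / b ^ n)) * endless_prob \<alpha> (R / b ^ n) \<le> endless_prob \<alpha> t"
    using \<alpha> by (intro endless_prob_growth) auto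
  moreover have "0 < exp (- (t - R / b ^ n)) * endless_prob \<alpha> (R / b ^ n)" using pos by simp
  ultimately show ?thesis by linarith
qed

section \<open>Transfer to the given cascade\<close>

lemma (in prob_space) distr_clocks:
  fixes T :: "nat list \<Rightarrow> 'a \<Rightarrow> real"
  assumes indep: "indep_vars (\<lambda>_. borel) T tree_vertices"
    and exp: "\<And>v. v \<in> tree_vertices \<Longrightarrow> distributed M lborel (T v) (exponential_density 1)"
  shows "distr M clock_law (\<lambda>\<omega>. \<lambda>v\<in>tree_vertices. T v \<omega>) = clock_law"
proof -
  have rv: "random_variable borel (T v)" if "v \<in> tree_vertices" for v
    using distributed_measurable[OF exp[OF that]] by simp
  have law: "distr M borel (T v) = exp_law" if "v \<in> tree_vertices" for v
    using distributed_distr_eq_density[OF exp[OF that]] distr_cong[of M M borel lborel "T v" "T v"]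
    by (simp add: exp_law_def)
  have sets_eq: "sets clock_law = sets (\<Pi>\<^sub>M v\<in>tree_vertices. borel)"
    unfolding clock_law_def by (rule sets_PiM_cong) auto
  have "distr M clock_law (\<lambda>\<omega>. \<lambda>v\<in>tree_vertices. T v \<omega>) =
      distr M (\<Pi>\<^sub>M v\<in>tree_vertices. borel) (\<lambda>\<omega>. \<lambda>v\<in>tree_vertices. T v \<omega>)"
    by (rule distr_cong) (simp_all add: sets_eq)
  also have "\<dots> = (\<Pi>\<^sub>M v\<in>tree_vertices. distr M borel (T v))"
    using indep_vars_iff_distr_eq_PiM'[of tree_vertices T "\<lambda>_. borel"] indep rv Nil_tree by blast
  also have "\<dots> = clock_law"
    unfolding clock_law_def by (rule PiM_cong) (auto simp: law)
  finally show ?thesis .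
qed

lemma AE_clocks_nonneg: "AE f in clock_law. \<forall>v\<in>tree_vertices. 0 \<le> f v"
proof -
  have "AE x in exp_law. 0 \<le> x"
    unfolding exp_law_def by (subst AE_density) (auto simp: exponential_density_def)
  then have "AE f in clock_law. 0 \<le> f v" if "v \<in> tree_vertices" for v
    unfolding clock_law_def using that by (rule clocks.AE_component[rotated])
  then show ?thesis by (simp add: AE_ball_countable)
qed

lemma finite_tree_iff_bounded_depth:
  assumes "S \<subseteq> tree_vertices"
  shows "finite S \<longleftrightarrow> (\<exists>n. \<forall>v\<in>S. length v < n)"
proof
  assume "finite S"
  then have "finite (length ` S)" by simp
  then show "\<exists>n. \<forall>v\<in>S. length v < n"
    unfolding finite_nat_set_iff_bounded by auto
next
  assume "\<exists>n. \<forall>v\<in>S. length v < n"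
  then obtain n where n: "\<And>v. v \<in> S \<Longrightarrow> length v < n" by blast
  have "S \<subseteq> {v. set v \<subseteq> {1, 2} \<and> length v \<le> n}"
    using assms n by (fastforce simp: tree_vertices_def in_lists_conv_set)
  then show "finite S"
    by (rule finite_subset) (simp add: finite_lists_length_le)
qed

lemma t_leaves_eq:
  assumes \<alpha>: "0 < \<alpha>" and t: "0 \<le> t" and nonneg: "\<And>v. v \<in> tree_vertices \<Longrightarrow> 0 \<le> T v \<omega>"
  shows "t_leaves \<alpha> T t \<omega> = {v \<in> tree_vertices. is_leaf \<alpha> v t (\<lambda>v\<in>tree_vertices. T v \<omega>)}"
proof (intro set_eqI)
  fix v
  show "v \<in> t_leaves \<alpha> T t \<omega> \<longleftrightarrow>
    v \<in> {v \<in> tree_vertices. is_leaf \<alpha> v t (\<lambda>v\<in>tree_vertices. T v \<omega>)}"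
  proof (cases "v \<in> tree_vertices")
    case True
    then have take: "take j v \<in> tree_vertices" for j
      using set_take_subset[of j v] by (auto simp: tree_vertices_def in_lists_conv_set)
    have sum: "(\<Sum>j\<in>J. riccati_cascade \<alpha> T (take j v) \<omega>) =
        ereal (\<Sum>j\<in>J. \<alpha> powi (- int j) * (\<lambda>v\<in>tree_vertices. T v \<omega>) (take j v))"
      if "J \<subseteq> {..length v}" for J
      using that \<alpha> take unfolding sum_ereal[symmetric]
      by (intro sum.cong) (auto simp: riccati_cascade_def min_def)
    have "{..<length v} \<subseteq> {..length v}" by auto
    then show ?thesis
      using True is_leaf_iff[OF \<alpha> True t, of "\<lambda>v\<in>tree_vertices. T v \<omega>"] nonneg
      by (simp add: t_leaves_def sum)
  qed (simp add: t_leaves_def)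
qed

text \<open>
  The tree has finitely many vertices of each depth, so on the almost sure event that all clocks are
  nonnegative, infinitely many leaves means leaves of unbounded depth.
\<close>

lemma (in prob_space) prob_finite_crossing:
  fixes T :: "nat list \<Rightarrow> 'a \<Rightarrow> real"
  assumes indep: "indep_vars (\<lambda>_. borel) T tree_vertices"
    and exp: "\<And>v. v \<in> tree_vertices \<Longrightarrow> distributed M lborel (T v) (exponential_density 1)"
    and \<alpha>: "0 < \<alpha>" and t: "0 \<le> t"
  shows "prob (finite_crossing_event M \<alpha> T t) = 1 - endless_prob \<alpha> t"
proof -
  let ?X = "\<lambda>\<omega>. \<lambda>v\<in>tree_vertices. T v \<omega>"
  let ?E = "\<Inter>n. leaf_event \<alpha> {n..} t"
  have rv: "random_variable borel (T v)" if "v \<in> tree_vertices" for v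
    using distributed_measurable[OF exp[OF that]] by simp
  have X: "?X \<in> M \<rightarrow>\<^sub>M clock_law"
    unfolding clock_law_def using rv by (intro measurable_restrict) (simp cong: measurable_cong_sets)
  have D: "distr M clock_law ?X = clock_law" by (rule distr_clocks[OF indep exp])
  have E: "?E \<in> sets clock_law" by (intro sets.countable_INT) auto
  have "AE f in distr M clock_law ?X. \<forall>v\<in>tree_vertices. 0 \<le> f v"
    using AE_clocks_nonneg unfolding D .
  then have "AE \<omega> in M. \<forall>v\<in>tree_vertices. 0 \<le> ?X \<omega> v"
    by (rule AE_distrD[OF X])
  then have "AE \<omega> in M. \<omega> \<in> finite_crossing_event M \<alpha> T t \<longleftrightarrow> \<omega> \<in> ?X -` (space clock_law - ?E) \<inter> space M"
  proof (eventually_elim, goal_cases)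
    case (1 \<omega>)
    then have "t_leaves \<alpha> T t \<omega> = {v \<in> tree_vertices. is_leaf \<alpha> v t (?X \<omega>)}"
      using \<alpha> t by (intro t_leaves_eq) auto
    moreover have "?X \<omega> \<in> space clock_law" by (simp add: space_clock_law)
    ultimately show ?case
      by (auto simp: finite_crossing_event_def finite_tree_iff_bounded_depth leaf_event_def not_less)
        (meson not_le)+
  qed
  then have "prob (finite_crossing_event M \<alpha> T t) = prob (?X -` (space clock_law - ?E) \<inter> space M)"
    using E X rv by (intro measure_eq_AE finite_crossing_event_sets measurable_sets[OF X]) auto
  also have "\<dots> = measure (distr M clock_law ?X) (space clock_law - ?E)"
    using E X by (simp add: measure_distr)
  also have "\<dots> = 1 - endless_prob \<alpha> t"
    unfolding D endless_prob_def by (rule clock_law.prob_compl[OF E])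
  finally show ?thesis .
qed

text \<open>
  For a vertex \<open>v\<close> of length at least two, the lower sum already contains the infinite term at depth one.
\<close>

lemma finite_t_leaves_alpha_0:
  "finite (t_leaves 0 T t \<omega>)"
proof -
  have "length v < 2" if v: "v \<in> t_leaves 0 T t \<omega>" for v
  proof (rule ccontr)
    assume "\<not> length v < 2"
    then have v2: "1 < length v" by simp
    have "riccati_cascade 0 T (take 1 v) \<omega> = \<infinity>" using v2 by (simp add: riccati_cascade_def)
    then have "(\<Sum>j<length v. riccati_cascade 0 T (take j v) \<omega>) = \<infinity>"
      using v2 by (subst sum_Pinfty) auto
    then show False using v by (simp add: t_leaves_def)
  qed
  moreover have "t_leaves 0 T t \<omega> \<subseteq> tree_vertices" by (auto simp: t_leaves_def)
  ultimately show ?thesis using finite_tree_iff_bounded_depth by blast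
qed

theorem proposition2p1:
  fixes M :: "'a measure" and T :: "nat list \<Rightarrow> 'a \<Rightarrow> real" and \<alpha> :: real
  assumes "prob_space M"
    and "prob_space.indep_vars M (\<lambda>_. borel) T tree_vertices"
    and "\<And>v. v \<in> tree_vertices \<Longrightarrow> distributed M lborel (T v) (exponential_density 1)"
    and "\<alpha> \<ge> 0"
  shows "\<forall>t>0.
    (\<alpha> \<in> {0..1} \<union> {2..} \<longrightarrow> measure M (finite_crossing_event M \<alpha> T t) = 1) \<and>
    (\<alpha> \<in> {1<..<2} \<longrightarrow> measure M (finite_crossing_event M \<alpha> T t) < 1)"
proof (intro allI impI)
  fix t :: real assume t: "0 < t"
  interpret prob_space M by fact
  show "(\<alpha> \<in> {0..1} \<union> {2..} \<longrightarrow> measure M (finite_crossing_event M \<alpha> T t) = 1) \<and>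
    (\<alpha> \<in> {1<..<2} \<longrightarrow> measure M (finite_crossing_event M \<alpha> T t) < 1)"
  proof (cases "\<alpha> = 0")
    case True
    then have "finite_crossing_event M \<alpha> T t = space M"
      by (simp add: finite_crossing_event_def finite_t_leaves_alpha_0)
    then show ?thesis using True by (simp add: prob_space)
  next
    case False
    then have \<alpha>: "0 < \<alpha>" using assms(4) by simp
    have prob: "prob (finite_crossing_event M \<alpha> T t) = 1 - endless_prob \<alpha> t"
      using assms(2,3) \<alpha> t by (intro prob_finite_crossing) auto
    have "endless_prob \<alpha> t = 0" if "\<alpha> \<le> 1"
      using LIMSEQ_unique[OF deep_prob_tendsto deep_prob_tendsto_0] \<alpha> that t by simp
    then show ?thesis
      using endless_prob_eq_0[of \<alpha> t] endless_prob_pos[of \<alpha> t] t unfolding prob by auto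
  qed
qed

end
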